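(* Let $n\geqslant 2$ and $S\in\mathsf{GL}_n(\mathbb{C})$. Then $S$ is a Perron similarity if and only if there is a unique positive integer $k\in\{1,\dots,n\}$ such that $Se_k=\alpha x$ and $e_k^\top S^{-1}=\beta y^\top$, where $\alpha$ and $\beta$ are nonzero complex numbers such that $\alpha\beta>0$ (i.e. $\alpha\beta$ is real and positive), and $x$ and $y$ are (entrywise) positive vectors in $\mathbb{R}^n$. Furthermore, if $S$ is a Perron similarity, then $\mathcal{C}(S)$ is nontrivial.
   Context: $\mathsf{GL}_n(\mathbb{C})$ is the set of invertible complex $n\times n$ matrices and $e_k$ is the $k$th canonical basis vector. For $n\geqslant2$, an $n\times n$ matrix $A$ is reducible if there is a permutation matrix $P$ with $P^\top AP=\begin{bmatrix}A_{11}&A_{12}\\0&A_{22}\end{bmatrix}$, where $A_{11},A_{22}$ are nonempty square matrices; otherwise $A$ is irreducible. A matrix is nonnegative (written $A\geqslant0$) if all its entries are real and nonnegative. $S\in\mathsf{GL}_n(\mathbb{C})$ is a Perron similarity if there is an irreducible nonnegative matrix $A$ and a diagonal matrix $D$ such that $A=SDS^{-1}$. For $x\in\mathbb{C}^n$, $D_x$ is the diagonal matrix with $(i,i)$-entry $x_i$; the spectracone is $\mathcal{C}(S):=\{x\in\mathbb{C}^n\mid SD_xS^{-1}\geqslant0\}$. It is called trivial if $\mathcal{C}(S)=\{\alpha e\mid\alpha\geqslant0\}$, where $e$ is the all-ones vector, and nontrivial otherwise. *)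

theory Defs
  imports
    "Jordan_Normal_Form.Determinant"
    "Jordan_Normal_Form.Gauss_Jordan_Elimination"
begin

text \<open>Rows, columns and vector components are indexed from 0, as in
  \<^theory>\<open>Jordan_Normal_Form.Matrix\<close>.\<close>

definition permutation_mat :: "complex mat \<Rightarrow> bool" where
  "permutation_mat P \<longleftrightarrow>
     (\<exists>\<pi>. \<pi> permutes {..<dim_row P} \<and>
       P = mat (dim_row P) (dim_row P) (\<lambda>(i, j). if i = \<pi> j then 1 else 0))"

definition reducible_mat :: "complex mat \<Rightarrow> bool" where
  "reducible_mat A \<longleftrightarrow>
     (\<exists>P p q A11 A12 A22.
        P \<in> carrier_mat (dim_row A) (dim_row A) \<and> permutation_mat P \<and>
        0 < p \<and> 0 < q \<and>
        A11 \<in> carrier_mat p p \<and> A12 \<in> carrier_mat p q \<and> A22 \<in> carrier_mat q q \<and>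
        transpose_mat P * A * P = four_block_mat A11 A12 (0\<^sub>m q p) A22)"

text \<open>Only meaningful for square matrices of size at least 2 (by this definition
  every matrix of size 1, including the zero matrix, would be irreducible).\<close>

definition irreducible_mat :: "complex mat \<Rightarrow> bool" where
  "irreducible_mat A \<longleftrightarrow> square_mat A \<and> \<not> reducible_mat A"

definition nonneg_mat :: "complex mat \<Rightarrow> bool" where
  "nonneg_mat A \<longleftrightarrow>
     (\<forall>i<dim_row A. \<forall>j<dim_col A. A $$ (i, j) \<in> \<real> \<and> 0 \<le> Re (A $$ (i, j)))"

definition positive_vec :: "real vec \<Rightarrow> bool" where
  "positive_vec x \<longleftrightarrow> (\<forall>i<dim_vec x. 0 < x $ i)"

text \<open>The library's Gauss-Jordan inverse is an option; the value below is
  meaningful for invertible matrices only.\<close>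

definition inv_mat :: "complex mat \<Rightarrow> complex mat" where
  "inv_mat S = the (mat_inverse S)"

lemma inv_mat:
  assumes S: "S \<in> carrier_mat n n" and inv: "invertible_mat S"
  shows "inv_mat S \<in> carrier_mat n n"
    and "S * inv_mat S = 1\<^sub>m n"
    and "inv_mat S * S = 1\<^sub>m n"
proof -
  obtain B where B: "S * B = 1\<^sub>m n" "B * S = 1\<^sub>m (dim_row B)"
    using inv S by (auto simp: invertible_mat_def inverts_mat_def)
  have "dim_col B = n" using arg_cong[OF B(1), of dim_col] by simp
  moreover have "dim_row B = n" using arg_cong[OF B(2), of dim_col] S by simp
  ultimately have "B \<in> carrier_mat n n" by auto
  hence "S \<in> Units (ring_mat TYPE(complex) n ())"
    using S B by (auto simp: Units_def ring_mat_def)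
  then obtain C where C: "mat_inverse S = Some C"
    using mat_inverse(1)[OF S] by fastforce
  show "inv_mat S \<in> carrier_mat n n" "S * inv_mat S = 1\<^sub>m n" "inv_mat S * S = 1\<^sub>m n"
    using mat_inverse(2)[OF S C] by (simp_all add: inv_mat_def C)
qed

definition perron_similarity :: "complex mat \<Rightarrow> bool" where
  "perron_similarity S \<longleftrightarrow>
     square_mat S \<and> invertible_mat S \<and>
     (\<exists>A D. A \<in> carrier_mat (dim_row S) (dim_row S) \<and> irreducible_mat A \<and> nonneg_mat A \<and>
        D \<in> carrier_mat (dim_row S) (dim_row S) \<and> diagonal_mat D \<and>
        A = S * D * inv_mat S)"

definition spectracone :: "complex mat \<Rightarrow> complex vec set" where
  "spectracone S =
     {x \<in> carrier_vec (dim_row S).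
        nonneg_mat (S * mat_diag (dim_row S) (\<lambda>i. x $ i) * inv_mat S)}"

definition trivial_spectracone :: "complex mat \<Rightarrow> bool" where
  "trivial_spectracone S \<longleftrightarrow>
     spectracone S =
       {complex_of_real a \<cdot>\<^sub>v vec (dim_row S) (\<lambda>_. 1) |a. 0 \<le> a}"

end

theory Submission
  imports Defs
begin

text \<open>
  Write \<open>T\<close> for the inverse of \<open>S\<close>.  The condition on the column \<open>S e\<^sub>k\<close> and the row
  \<open>e\<^sub>k\<^sup>T T\<close> says exactly that the rank-one spectral projection
  \<open>(S e\<^sub>k) (e\<^sub>k\<^sup>T T) = S D T\<close>, where \<open>D\<close> is the diagonal matrix of \<open>e\<^sub>k\<close>, has only positive
  entries (lemma \<open>positive_spectral_projection_iff\<close>).  Three parts of the theorem are immediate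
  from this.  A positive projection is itself an irreducible nonnegative matrix diagonalized by
  \<open>S\<close>, so \<open>S\<close> is a Perron similarity.  It puts \<open>e\<^sub>k\<close> into the spectracone, and \<open>e\<^sub>k\<close> is not a
  multiple of the all-ones vector, as \<open>n \<ge> 2\<close>.  Finally, two different spectral projections have
  product \<open>0\<close>, whereas a product of positive matrices is positive; hence \<open>k\<close> is unique.

  The existence of \<open>k\<close> for an irreducible nonnegative \<open>A = S D T\<close> is the Perron-Frobenius theorem
  for diagonalizable matrices, where it has an elementary proof.  Some power
  \<open>M = (1 + A)\<^sup>m\<close> is entrywise positive (lemma \<open>irreducible_imp_power_positive\<close>), and
  \<open>S\<close> diagonalizes it too.  Let \<open>\<rho>\<close> be the largest modulus of an eigenvalue of \<open>M\<close>, attained for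
  the index \<open>k\<close>, and let \<open>v = S e\<^sub>k\<close>.  The triangle inequality gives
  \<open>M \<bar>v\<bar> \<ge> \<rho> \<bar>v\<bar>\<close>.  If some component were strict, then the positive vector
  \<open>w = M \<bar>v\<bar>\<close> would satisfy \<open>M w \<ge> \<sigma> w\<close> for some \<open>\<sigma> > \<rho>\<close>, so
  \<open>M\<^sup>j w\<close> would grow at least like \<open>\<sigma>\<^sup>j\<close>; but a diagonalizable matrix allows only growth
  \<open>O(\<rho>\<^sup>j)\<close> (lemma \<open>growth_rate_le_eigenvalue_bound\<close>).  So equality holds in the triangle
  inequality, with positive weights, and all components of \<open>v\<close> have a common phase and are nonzero
  (lemma \<open>dominant_eigenvector_has_constant_phase\<close>).  Applied to the transpose of \<open>M\<close>, the same
  argument treats the row \<open>e\<^sub>k\<^sup>T T\<close>.  As this row times that column is \<open>1\<close>, the two phases are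
  inverse to each other, which makes the projection positive.
\<close>

section \<open>Dominant eigenvectors of a diagonalizable positive matrix\<close>

text \<open>After rotation by the conjugate phase of the sum, the real parts of the summands must add up
  to the sum of their moduli, so each of them equals its modulus.\<close>

lemma equality_in_weighted_triangle_inequality:
  fixes v :: "'a \<Rightarrow> complex"
  assumes fin: "finite I" and p: "\<And>i. i \<in> I \<Longrightarrow> 0 < p i"
    and eq: "cmod (\<Sum>i\<in>I. of_real (p i) * v i) = (\<Sum>i\<in>I. p i * cmod (v i))"
  shows "\<exists>\<alpha>. cmod \<alpha> = 1 \<and> (\<forall>i\<in>I. v i = \<alpha> * of_real (cmod (v i)))"
proof -
  define s where "s = (\<Sum>i\<in>I. of_real (p i) * v i)"
  define \<alpha> where "\<alpha> = (if s = 0 then 1 else sgn s)"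
  have \<alpha>: "cmod \<alpha> = 1" by (simp add: \<alpha>_def norm_sgn)
  have \<alpha>\<alpha>: "\<alpha> * cnj \<alpha> = 1" using \<alpha> by (simp add: complex_mult_cnj cmod_def)
  have "s = \<alpha> * of_real (cmod s)"
    by (auto simp: \<alpha>_def sgn_div_norm scaleR_conv_of_real)
  hence "cnj \<alpha> * s = of_real (cmod s)" using \<alpha>\<alpha> by (metis mult.assoc mult.commute mult_1)
  hence "cmod s = Re (cnj \<alpha> * s)" by simp
  also have "\<dots> = (\<Sum>i\<in>I. p i * Re (cnj \<alpha> * v i))"
    by (simp add: s_def sum_distrib_left Re_sum algebra_simps)
  finally have tot: "(\<Sum>i\<in>I. p i * (cmod (v i) - Re (cnj \<alpha> * v i))) = 0"
    using eq by (simp add: s_def[symmetric] right_diff_distrib sum_subtractf)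
  have le: "Re (cnj \<alpha> * v i) \<le> cmod (v i)" for i
    using complex_Re_le_cmod[of "cnj \<alpha> * v i"] \<alpha> by (simp add: norm_mult)
  have "v i = \<alpha> * of_real (cmod (v i))" if i: "i \<in> I" for i
  proof -
    have "p i * (cmod (v i) - Re (cnj \<alpha> * v i)) = 0"
      using tot le p i by (subst (asm) sum_nonneg_eq_0_iff[OF fin]) (auto simp: less_imp_le)
    hence re: "Re (cnj \<alpha> * v i) = cmod (cnj \<alpha> * v i)"
      using p[OF i] \<alpha> by (simp add: norm_mult)
    hence "(Im (cnj \<alpha> * v i))\<^sup>2 = 0" using cmod_power2[of "cnj \<alpha> * v i"] by simp
    hence "cnj \<alpha> * v i = of_real (cmod (v i))"
      using re \<alpha> by (intro complex_eqI) (simp_all add: norm_mult)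
    thus ?thesis using \<alpha>\<alpha> by (metis mult.assoc mult_1)
  qed
  with \<alpha> show ?thesis by blast
qed

text \<open>The columns of \<open>s\<close> are eigenvectors of the nonnegative matrix \<open>m\<close>, and \<open>w\<close> is a combination
  of them.  Iterating \<open>m\<close> on \<open>w\<close> therefore yields vectors of size \<open>O(\<rho>\<^sup>j)\<close>, while monotonicity of
  \<open>m\<close> bounds them from below by \<open>\<sigma>\<^sup>j w\<close>.\<close>

lemma growth_rate_le_eigenvalue_bound:
  fixes m :: "nat \<Rightarrow> nat \<Rightarrow> real" and s :: "nat \<Rightarrow> nat \<Rightarrow> complex"
  assumes eig: "\<And>a i. a < n \<Longrightarrow> i < n \<Longrightarrow> (\<Sum>b<n. of_real (m a b) * s b i) = s a i * d i"
    and span: "\<And>a. a < n \<Longrightarrow> of_real (w a) = (\<Sum>i<n. s a i * c i)"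
    and d: "\<And>i. i < n \<Longrightarrow> cmod (d i) \<le> \<rho>"
    and m: "\<And>a b. a < n \<Longrightarrow> b < n \<Longrightarrow> 0 \<le> m a b"
    and e: "e < n" "0 < w e"
    and \<sigma>: "\<And>a. a < n \<Longrightarrow> \<sigma> * w a \<le> (\<Sum>b<n. m a b * w b)"
  shows "\<sigma> \<le> \<rho>"
proof (rule ccontr)
  assume "\<not> \<sigma> \<le> \<rho>"
  moreover have \<rho>0: "0 \<le> \<rho>" using d[OF e(1)] norm_ge_zero order_trans by blast
  \<comment> \<open>\<open>\<rho>\<close> may be \<open>0\<close>; a positive bound \<open>\<tau>\<close> in between can be divided by.\<close>
  ultimately obtain \<tau> where \<tau>: "\<rho> < \<tau>" "\<tau> < \<sigma>" by (meson dense not_le)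
  hence pos: "0 < \<tau>" "0 < \<sigma>" using \<rho>0 by auto
  define u where "u j = ((\<lambda>f a. \<Sum>b<n. m a b * f b) ^^ j) w" for j
  have u0: "u 0 = w" and uS: "u (Suc j) = (\<lambda>a. \<Sum>b<n. m a b * u j b)" for j
    by (simp_all add: u_def)
  have spectral: "of_real (u j a) = (\<Sum>i<n. s a i * d i ^ j * c i)" if "a < n" for j a
    using that
  proof (induction j arbitrary: a)
    case 0
    thus ?case by (simp add: u0 span)
  next
    case (Suc j)
    have "of_real (u (Suc j) a) = (\<Sum>b<n. \<Sum>i<n. of_real (m a b) * (s b i * d i ^ j * c i))"
      by (simp add: uS Suc.IH sum_distrib_left)
    also have "\<dots> = (\<Sum>i<n. (\<Sum>b<n. of_real (m a b) * s b i) * d i ^ j * c i)"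
      by (subst sum.swap) (simp add: sum_distrib_right mult.assoc)
    also have "\<dots> = (\<Sum>i<n. s a i * d i ^ Suc j * c i)"
      using Suc.prems by (simp add: eig mult.assoc)
    finally show ?case .
  qed
  have lower: "\<sigma> ^ j * w a \<le> u j a" if "a < n" for j a
    using that
  proof (induction j arbitrary: a)
    case 0
    thus ?case by (simp add: u0)
  next
    case (Suc j)
    have "\<sigma> ^ Suc j * w a = \<sigma> ^ j * (\<sigma> * w a)" by simp
    also have "\<dots> \<le> \<sigma> ^ j * (\<Sum>b<n. m a b * w b)"
      using \<sigma>[OF Suc.prems] pos by (intro mult_left_mono) auto
    also have "\<dots> = (\<Sum>b<n. m a b * (\<sigma> ^ j * w b))"
      by (simp add: sum_distrib_left mult.left_commute)
    also have "\<dots> \<le> u (Suc j) a"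
      unfolding uS using Suc m by (intro sum_mono mult_left_mono) auto
    finally show ?case .
  qed
  define C where "C = (\<Sum>i<n. cmod (s e i * c i))"
  have upper: "u j e \<le> \<tau> ^ j * C" for j
  proof -
    have "u j e \<le> cmod (of_real (u j e))" by simp
    also have "\<dots> \<le> (\<Sum>i<n. cmod (s e i * d i ^ j * c i))"
      using spectral[OF e(1)] norm_sum by metis
    also have "\<dots> \<le> (\<Sum>i<n. \<tau> ^ j * cmod (s e i * c i))"
    proof (rule sum_mono)
      fix i assume "i \<in> {..<n}"
      hence "cmod (d i) ^ j \<le> \<tau> ^ j" using d[of i] \<tau> by (intro power_mono) auto
      from mult_right_mono[OF this norm_ge_zero[of "s e i * c i"]]
      show "cmod (s e i * d i ^ j * c i) \<le> \<tau> ^ j * cmod (s e i * c i)"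
        by (simp add: norm_mult norm_power mult_ac)
    qed
    finally show ?thesis by (simp add: C_def sum_distrib_left)
  qed
  have "(\<sigma> / \<tau>) ^ j \<le> C / w e" for j
    using order_trans[OF lower[OF e(1)] upper, of j] pos e(2)
    by (simp add: power_divide field_simps)
  moreover obtain j where "C / w e < (\<sigma> / \<tau>) ^ j"
    using real_arch_pow[of "\<sigma> / \<tau>"] \<tau> pos by auto
  ultimately show False by (meson not_le)
qed

text \<open>Matrices are functions of two indices here, so that the lemma serves for right eigenvectors
  and, with swapped indices, for left eigenvectors.  The inverse \<open>t\<close> of the eigenvector matrix
  \<open>s\<close> is there to expand an arbitrary vector in eigenvectors.\<close>

lemma dominant_eigenvector_has_constant_phase:
  fixes m :: "nat \<Rightarrow> nat \<Rightarrow> real" and s t :: "nat \<Rightarrow> nat \<Rightarrow> complex"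
  assumes pos: "\<And>a b. a < n \<Longrightarrow> b < n \<Longrightarrow> 0 < m a b"
    and eig: "\<And>a i. a < n \<Longrightarrow> i < n \<Longrightarrow> (\<Sum>b<n. of_real (m a b) * s b i) = s a i * d i"
    and inv: "\<And>a b. a < n \<Longrightarrow> b < n \<Longrightarrow> (\<Sum>i<n. s a i * t i b) = (if a = b then 1 else 0)"
    and k: "k < n" and dominant: "\<And>i. i < n \<Longrightarrow> cmod (d i) \<le> cmod (d k)"
    and nonzero: "a1 < n" "s a1 k \<noteq> 0"
  shows "\<exists>\<alpha>. \<forall>a<n. s a k = \<alpha> * of_real (cmod (s a k)) \<and> s a k \<noteq> 0"
proof -
  define \<rho> where "\<rho> = cmod (d k)"
  define x where "x a = cmod (s a k)" for a
  define w where "w a = (\<Sum>b<n. m a b * x b)" for a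
  define z where "z a = (\<Sum>b<n. m a b * w b)" for a
  have x0: "0 \<le> x a" for a by (simp add: x_def)
  have w_pos: "0 < w a" if "a < n" for a
    unfolding w_def using that pos[OF that] x0 nonzero
    by (intro sum_pos2[of _ a1]) (auto simp: x_def less_imp_le)
  have le: "\<rho> * x a \<le> w a" if "a < n" for a
  proof -
    have "\<rho> * x a = cmod (\<Sum>b<n. of_real (m a b) * s b k)"
      by (simp add: eig[OF that k] \<rho>_def x_def norm_mult)
    also have "\<dots> \<le> (\<Sum>b<n. cmod (of_real (m a b) * s b k))" by (rule norm_sum)
    also have "\<dots> = w a"
      unfolding w_def x_def
      by (intro sum.cong refl) (use pos[OF that] in \<open>simp add: norm_mult abs_of_pos\<close>)
    finally show ?thesis .
  qed
  have eq: "w a = \<rho> * x a" if a: "a < n" for a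
  proof (rule ccontr)
    assume "w a \<noteq> \<rho> * x a"
    hence strict: "\<rho> * x a < w a" using le[OF a] by simp
    have z: "\<rho> * w b < z b" if b: "b < n" for b
    proof -
      have "0 < (\<Sum>c<n. m b c * (w c - \<rho> * x c))"
        using a strict pos[OF b] le
        by (intro sum_pos2[of _ a]) (auto simp: less_imp_le)
      thus ?thesis
        by (simp add: z_def w_def[of b] sum_subtractf right_diff_distrib sum_distrib_left mult_ac)
    qed
    \<comment> \<open>\<open>m\<close> turns one strict component into strictness everywhere, so a factor \<open>\<sigma>\<close> that beats
      \<open>\<rho>\<close> in all components at once exists.\<close>
    define \<sigma> where "\<sigma> = Min ((\<lambda>b. z b / w b) ` {..<n})"
    have "\<rho> < \<sigma>"
      unfolding \<sigma>_def using k z w_pos by (subst Min_gr_iff) (auto simp: field_simps)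
    moreover have "\<sigma> \<le> \<rho>"
    proof (rule growth_rate_le_eigenvalue_bound[OF eig])
      fix b assume b: "b < n"
      have "(\<Sum>i<n. s b i * (\<Sum>c<n. t i c * of_real (w c)))
          = (\<Sum>c<n. (\<Sum>i<n. s b i * t i c) * of_real (w c))"
        by (simp add: sum_distrib_left sum_distrib_right mult.assoc) (rule sum.swap)
      also have "\<dots> = (\<Sum>c<n. if b = c then of_real (w c) else 0)"
        using b by (intro sum.cong refl) (simp add: inv)
      also have "\<dots> = of_real (w b)" using b by simp
      finally show "of_real (w b) = (\<Sum>i<n. s b i * (\<Sum>c<n. t i c * of_real (w c)))" ..
    next
      fix b assume b: "b < n"
      have "\<sigma> \<le> z b / w b" unfolding \<sigma>_def using b by (intro Min_le) auto
      thus "\<sigma> * w b \<le> (\<Sum>c<n. m b c * w c)"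
        using w_pos[OF b] by (simp add: z_def field_simps)
    qed (use pos dominant w_pos k in \<open>auto simp: \<rho>_def less_imp_le\<close>)
    ultimately show False by simp
  qed
  \<comment> \<open>Any row of \<open>m\<close> supplies the positive weights; row \<open>k\<close> is at hand.\<close>
  have "cmod (\<Sum>b\<in>{..<n}. of_real (m k b) * s b k) = (\<Sum>b\<in>{..<n}. m k b * cmod (s b k))"
    using eq[OF k] unfolding eig[OF k k] by (simp add: norm_mult w_def x_def \<rho>_def)
  from equality_in_weighted_triangle_inequality[OF _ _ this] pos[OF k]
  obtain \<alpha> where "\<forall>b<n. s b k = \<alpha> * of_real (cmod (s b k))" by auto
  moreover have "s a k \<noteq> 0" if "a < n" for a
    using w_pos[OF that] eq[OF that] by (auto simp: x_def)
  ultimately show ?thesis by blast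
qed

section \<open>Irreducibility\<close>

lemma index_mult_mat_sum:
  assumes "A \<in> carrier_mat n r" "B \<in> carrier_mat r q" "i < n" "j < q"
  shows "(A * B) $$ (i, j) = (\<Sum>l<r. A $$ (i, l) * B $$ (l, j))"
  using assms by (auto simp: scalar_prod_def atLeast0LessThan intro!: sum.cong)

lemma index_permuted_mat:
  fixes A :: "complex mat"
  assumes A: "A \<in> carrier_mat n n" and \<pi>: "\<pi> permutes {..<n}"
    and P: "P = mat n n (\<lambda>(i, j). if i = \<pi> j then 1 else 0)" and ij: "i < n" "j < n"
  shows "(transpose_mat P * A * P) $$ (i, j) = A $$ (\<pi> i, \<pi> j)"
proof -
  have Pc: "P \<in> carrier_mat n n" by (simp add: P)
  have P_index: "P $$ (a, b) = (if a = \<pi> b then 1 else 0)" if "a < n" "b < n" for a b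
    using that by (simp add: P)
  have \<pi>n: "\<pi> l < n" if "l < n" for l using permutes_in_image[OF \<pi>, of l] that by simp
  have PA: "(transpose_mat P * A) $$ (i, l) = A $$ (\<pi> i, l)" if "l < n" for l
  proof -
    have "(transpose_mat P * A) $$ (i, l) = (\<Sum>a<n. P $$ (a, i) * A $$ (a, l))"
      using Pc A ij that by (subst index_mult_mat_sum[where r = n]) auto
    also have "\<dots> = (\<Sum>a<n. if a = \<pi> i then A $$ (a, l) else 0)"
      using ij by (intro sum.cong refl) (simp add: P_index)
    finally show ?thesis using \<pi>n[OF ij(1)] by simp
  qed
  have "(transpose_mat P * A * P) $$ (i, j)
      = (\<Sum>l<n. (transpose_mat P * A) $$ (i, l) * P $$ (l, j))"
    using Pc A ij by (subst index_mult_mat_sum[where r = n]) auto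
  also have "\<dots> = (\<Sum>l<n. if l = \<pi> j then A $$ (\<pi> i, l) else 0)"
    using ij by (intro sum.cong refl) (simp add: PA P_index)
  finally show ?thesis using \<pi>n[OF ij(2)] by simp
qed

text \<open>The lower left block of a block triangular form is nonempty and consists of zero entries.\<close>

lemma irreducible_if_no_zero_entry:
  assumes A: "A \<in> carrier_mat n n" and nz: "\<And>i j. i < n \<Longrightarrow> j < n \<Longrightarrow> A $$ (i, j) \<noteq> 0"
  shows "irreducible_mat A"
  unfolding irreducible_mat_def
proof
  show "square_mat A" using A by simp
  show "\<not> reducible_mat A"
  proof
    assume "reducible_mat A"
    then obtain P p q A11 A12 A22 \<pi> where
      P: "P \<in> carrier_mat n n" "P = mat n n (\<lambda>(i, j). if i = \<pi> j then 1 else 0)"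
      and \<pi>: "\<pi> permutes {..<n}"
      and pq: "0 < p" "0 < q" "A11 \<in> carrier_mat p p" "A12 \<in> carrier_mat p q"
        "A22 \<in> carrier_mat q q"
      and eq: "transpose_mat P * A * P = four_block_mat A11 A12 (0\<^sub>m q p) A22"
      using A unfolding reducible_mat_def permutation_mat_def by (auto; metis)
    have n: "n = p + q" using arg_cong[OF eq, of dim_row] P pq by simp
    have "(transpose_mat P * A * P) $$ (p, 0) = 0"
      unfolding eq using pq by simp
    hence "A $$ (\<pi> p, \<pi> 0) = 0"
      using index_permuted_mat[OF A \<pi> P(2), of p 0] n pq by simp
    moreover have "\<pi> p < n" "\<pi> 0 < n" using permutes_in_image[OF \<pi>] n pq by auto
    ultimately show False using nz by blast
  qed
qed

text \<open>In graph terms, no edge leaves \<open>R\<close>.  Ordering the indices outside \<open>R\<close> first puts the zero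
  entries with row in \<open>R\<close> and column outside \<open>R\<close> into the lower left block.\<close>

lemma reducible_if_closed_set:
  assumes A: "A \<in> carrier_mat n n"
    and R: "R \<subseteq> {..<n}" "R \<noteq> {}" "R \<noteq> {..<n}"
    and closed: "\<And>i j. i \<in> R \<Longrightarrow> j < n \<Longrightarrow> j \<notin> R \<Longrightarrow> A $$ (i, j) = 0"
  shows "reducible_mat A"
proof -
  define p where "p = card ({..<n} - R)"
  define q where "q = card R"
  have fin: "finite R" using R finite_subset by blast
  have n: "n = p + q"
    using card_Diff_subset[OF fin R(1)] card_mono[OF _ R(1)] by (simp add: p_def q_def)
  have pq: "0 < p" "0 < q" using R fin by (auto simp: p_def q_def card_gt_0_iff)
  obtain f where f: "bij_betw f {..<p} ({..<n} - R)"
    using finite_same_card_bij[of "{..<p}" "{..<n} - R"] by (auto simp: p_def)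
  obtain g where g: "bij_betw g {p..<n} R"
    using finite_same_card_bij[of "{p..<n}" R] fin n by (auto simp: q_def)
  define h where "h i = (if i < p then f i else g i)" for i
  have "bij_betw h ({..<p} \<union> {p..<n}) (({..<n} - R) \<union> R)"
  proof (rule bij_betw_combine)
    show "bij_betw h {..<p} ({..<n} - R)"
      using f by (subst bij_betw_cong[of _ h f]) (auto simp: h_def)
    show "bij_betw h {p..<n} R"
      using g by (subst bij_betw_cong[of _ h g]) (auto simp: h_def)
  qed auto
  moreover have "{..<p} \<union> {p..<n} = {..<n}" "({..<n} - R) \<union> R = {..<n}" using n R by auto
  ultimately have h: "bij_betw h {..<n} {..<n}" by simp
  define \<pi> where "\<pi> i = (if i \<in> {..<n} then h i else i)" for i
  have \<pi>: "\<pi> permutes {..<n}"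
  proof (rule bij_imp_permutes)
    show "bij_betw \<pi> {..<n} {..<n}"
      using h by (subst bij_betw_cong[of _ \<pi> h]) (auto simp: \<pi>_def)
  qed (simp add: \<pi>_def)
  define P :: "complex mat" where "P = mat n n (\<lambda>(i, j). if i = \<pi> j then 1 else 0)"
  define B where "B = transpose_mat P * A * P"
  have P: "P \<in> carrier_mat n n" "permutation_mat P"
    using \<pi> unfolding permutation_mat_def by (auto simp: P_def)
  have B: "B \<in> carrier_mat n n" using P A by (auto simp: B_def)
  have zero: "B $$ (i, j) = 0" if "p \<le> i" "i < n" "j < p" for i j
  proof -
    have "\<pi> i \<in> R" using bij_betwE[OF g] that by (auto simp: \<pi>_def h_def)
    moreover have "\<pi> j \<in> {..<n} - R" using bij_betwE[OF f] that by (auto simp: \<pi>_def h_def)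
    ultimately show ?thesis
      using index_permuted_mat[OF A \<pi> P_def, of i j] closed that by (simp add: B_def)
  qed
  define A11 where "A11 = mat p p (\<lambda>(i, j). B $$ (i, j))"
  define A12 where "A12 = mat p q (\<lambda>(i, j). B $$ (i, p + j))"
  define A22 where "A22 = mat q q (\<lambda>(i, j). B $$ (p + i, p + j))"
  have blocks: "A11 \<in> carrier_mat p p" "A12 \<in> carrier_mat p q" "A22 \<in> carrier_mat q q"
    by (simp_all add: A11_def A12_def A22_def)
  have "B = four_block_mat A11 A12 (0\<^sub>m q p) A22"
    by (rule eq_matI) (use B n zero in \<open>auto simp: A11_def A12_def A22_def\<close>)
  moreover have "dim_row A = n" using A by simp
  ultimately show ?thesis
    unfolding reducible_mat_def using P pq blocks by (metis B_def)
qed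

text \<open>The set of vertices that can be reached from \<open>i\<close> is closed.\<close>

lemma irreducible_imp_strongly_connected:
  assumes A: "A \<in> carrier_mat n n" and irr: "irreducible_mat A" and ij: "i < n" "j < n"
  shows "(i, j) \<in> {(a, b). a < n \<and> b < n \<and> A $$ (a, b) \<noteq> 0}\<^sup>*" (is "_ \<in> ?E\<^sup>*")
proof (rule ccontr)
  assume "(i, j) \<notin> ?E\<^sup>*"
  hence "reducible_mat A"
    using ij by (intro reducible_if_closed_set[OF A, of "{b. b < n \<and> (i, b) \<in> ?E\<^sup>*}"])
      (auto intro: rtrancl_into_rtrancl)
  thus False using irr by (simp add: irreducible_mat_def)
qed

text \<open>A path of length \<open>m\<close> from \<open>i\<close> to \<open>j\<close> makes entry \<open>(i, j)\<close> of the \<open>m\<close>-th power positive.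
  Adding the identity matrix puts a loop at each vertex, so that the entry stays positive for all
  larger exponents, and one exponent serves all pairs.\<close>

lemma irreducible_imp_power_positive:
  fixes R :: "real mat"
  assumes R: "R \<in> carrier_mat n n" and nonneg: "\<And>i j. i < n \<Longrightarrow> j < n \<Longrightarrow> 0 \<le> R $$ (i, j)"
    and irr: "irreducible_mat (map_mat complex_of_real R)"
  shows "\<exists>m. \<forall>i<n. \<forall>j<n. 0 < ((1\<^sub>m n + R) ^\<^sub>m m) $$ (i, j)"
proof -
  define B where "B = 1\<^sub>m n + R"
  have B: "B \<in> carrier_mat n n" using R by (simp add: B_def)
  have hom_R: "map_mat complex_of_real R \<in> carrier_mat n n" using R by simp
  have B_index: "B $$ (i, j) = (if i = j then 1 else 0) + R $$ (i, j)" if "i < n" "j < n" for i j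
    using that R by (simp add: B_def)
  have B0: "0 \<le> B $$ (i, j)" if "i < n" "j < n" for i j
    using that nonneg by (simp add: B_index)
  have step: "(B ^\<^sub>m Suc m) $$ (i, j) = (\<Sum>l<n. (B ^\<^sub>m m) $$ (i, l) * B $$ (l, j))"
    if "i < n" "j < n" for m i j
    using index_mult_mat_sum[OF pow_carrier_mat[OF B] B that] by simp
  have pow0: "0 \<le> (B ^\<^sub>m m) $$ (i, j)" if "i < n" "j < n" for m i j
    using that
  proof (induction m arbitrary: j)
    case 0
    thus ?case using B by simp
  next
    case (Suc m)
    thus ?case by (subst step) (auto intro!: sum_nonneg mult_nonneg_nonneg B0)
  qed
  have extend: "0 < (B ^\<^sub>m Suc m) $$ (i, j)"
    if "0 < (B ^\<^sub>m m) $$ (i, l)" "0 < B $$ (l, j)" "i < n" "l < n" "j < n" for m i l j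
    using that pow0 B0 by (subst step) (auto intro!: sum_pos2[of _ l])
  have ev: "\<forall>\<^sub>F m in sequentially. 0 < (B ^\<^sub>m m) $$ (i, j)" if ij: "i < n" "j < n" for i j
  proof -
    have "\<exists>m. 0 < (B ^\<^sub>m m) $$ (i, j)"
      using irreducible_imp_strongly_connected[OF hom_R irr ij]
    proof (induction rule: rtrancl_induct)
      case base
      have "0 < (B ^\<^sub>m 0) $$ (i, i)" using B ij by simp
      thus ?case ..
    next
      case (step l j)
      hence "0 < B $$ (l, j)" using R nonneg[of l j] by (auto simp: B_index)
      with step show ?case using extend ij by blast
    qed
    then obtain m0 where m0: "0 < (B ^\<^sub>m m0) $$ (i, j)" ..
    have "0 < (B ^\<^sub>m m) $$ (i, j)" if "m0 \<le> m" for m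
      using that
    proof (induction m rule: dec_induct)
      case (step m)
      have "0 < B $$ (j, j)" using ij nonneg[of j j] by (simp add: B_index)
      thus ?case using step extend ij by blast
    qed (rule m0)
    thus ?thesis by (auto simp: eventually_sequentially)
  qed
  hence "\<forall>\<^sub>F m in sequentially. \<forall>i\<in>{..<n}. \<forall>j\<in>{..<n}. 0 < (B ^\<^sub>m m) $$ (i, j)"
    by (auto intro!: eventually_ball_finite)
  from eventually_happens'[OF sequentially_bot this] show ?thesis by (auto simp: B_def)
qed

section \<open>Positive spectral projections\<close>

definition positive_spectral_projection :: "nat \<Rightarrow> complex mat \<Rightarrow> complex mat \<Rightarrow> nat \<Rightarrow> bool" where
  "positive_spectral_projection n S T k \<longleftrightarrow>
     (\<forall>i<n. \<forall>j<n. S $$ (i, k) * T $$ (k, j) \<in> \<real> \<and> 0 < Re (S $$ (i, k) * T $$ (k, j)))"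

text \<open>If all products \<open>S\<^sub>i\<^sub>k T\<^sub>k\<^sub>j\<close> are positive, then multiplication by \<open>T\<^sub>k\<^sub>k\<close> makes column
  \<open>k\<close> of \<open>S\<close> positive, and multiplication by \<open>S\<^sub>k\<^sub>k\<close> does so for row \<open>k\<close> of \<open>T\<close>.  This explains
  the scalars \<open>\<alpha> = 1 / T\<^sub>k\<^sub>k\<close> and \<open>\<beta> = 1 / S\<^sub>k\<^sub>k\<close> in the proof.\<close>

lemma positive_spectral_projection_iff:
  assumes S: "S \<in> carrier_mat n n" and T: "T \<in> carrier_mat n n"
  shows "k < n \<and> (\<exists>\<alpha> \<beta> x y.
            \<alpha> \<noteq> 0 \<and> \<beta> \<noteq> 0 \<and> \<alpha> * \<beta> \<in> \<real> \<and> 0 < Re (\<alpha> * \<beta>) \<and>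
            x \<in> carrier_vec n \<and> positive_vec x \<and>
            y \<in> carrier_vec n \<and> positive_vec y \<and>
            S *\<^sub>v unit_vec n k = \<alpha> \<cdot>\<^sub>v map_vec complex_of_real x \<and>
            mat_of_row (unit_vec n k) * T = \<beta> \<cdot>\<^sub>m mat_of_row (map_vec complex_of_real y))
         \<longleftrightarrow> k < n \<and> positive_spectral_projection n S T k" (is "_ \<and> ?L \<longleftrightarrow> _ \<and> ?R")
proof (rule conj_cong[OF refl], rule iffI)
  assume k: "k < n"
  have col: "S *\<^sub>v unit_vec n k = col S k" using S k by (intro eq_vecI) auto
  have row: "mat_of_row (unit_vec n k) * T = mat_of_row (row T k)"
    using T k by (intro eq_matI) (auto simp: scalar_prod_left_unit)
  {
    assume ?L
    then obtain \<alpha> \<beta> x y where \<alpha>\<beta>: "\<alpha> * \<beta> \<in> \<real>" "0 < Re (\<alpha> * \<beta>)"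
      and x: "x \<in> carrier_vec n" "positive_vec x" and y: "y \<in> carrier_vec n" "positive_vec y"
      and eqs: "col S k = \<alpha> \<cdot>\<^sub>v map_vec complex_of_real x"
        "mat_of_row (row T k) = \<beta> \<cdot>\<^sub>m mat_of_row (map_vec complex_of_real y)"
      unfolding col row by blast
    show ?R
      unfolding positive_spectral_projection_def
    proof (intro allI impI)
      fix i j assume ij: "i < n" "j < n"
      have s: "S $$ (i, k) = \<alpha> * of_real (x $ i)"
        using arg_cong[OF eqs(1), of "\<lambda>v. v $ i"] ij x S k by simp
      have t: "T $$ (k, j) = \<beta> * of_real (y $ j)"
        using arg_cong[OF eqs(2), of "\<lambda>M. M $$ (0, j)"] ij y T k by simp
      have p: "0 < x $ i * y $ j" using x y ij by (auto simp: positive_vec_def)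
      have "S $$ (i, k) * T $$ (k, j) = \<alpha> * \<beta> * of_real (x $ i * y $ j)" by (simp add: s t)
      thus "S $$ (i, k) * T $$ (k, j) \<in> \<real> \<and> 0 < Re (S $$ (i, k) * T $$ (k, j))"
        using \<alpha>\<beta> p by (auto elim!: Reals_cases simp del: of_real_mult simp: of_real_mult[symmetric])
    qed
  }
  assume R: ?R
  have real: "S $$ (i, k) * T $$ (k, j) = of_real (Re (S $$ (i, k) * T $$ (k, j)))"
    if "i < n" "j < n" for i j
    using R that unfolding positive_spectral_projection_def by (simp only: of_real_Re)
  have pos: "0 < Re (S $$ (i, k) * T $$ (k, j))" if "i < n" "j < n" for i j
    using R that unfolding positive_spectral_projection_def by blast
  have nz: "S $$ (k, k) \<noteq> 0" "T $$ (k, k) \<noteq> 0" using pos[OF k k] by auto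
  define r where "r = Re (S $$ (k, k) * T $$ (k, k))"
  define x where "x = vec n (\<lambda>i. Re (S $$ (i, k) * T $$ (k, k)))"
  define y where "y = vec n (\<lambda>j. Re (S $$ (k, k) * T $$ (k, j)))"
  define \<alpha> where "\<alpha> = 1 / T $$ (k, k)"
  define \<beta> where "\<beta> = 1 / S $$ (k, k)"
  have "\<alpha> * \<beta> = 1 / of_real r"
    using real[OF k k] by (simp add: \<alpha>_def \<beta>_def r_def mult.commute)
  hence \<alpha>\<beta>: "\<alpha> * \<beta> = of_real (1 / r)" by simp
  have r: "0 < r" using pos[OF k k] by (simp add: r_def)
  have "col S k = \<alpha> \<cdot>\<^sub>v map_vec complex_of_real x"
  proof (rule eq_vecI)
    fix i assume "i < dim_vec (\<alpha> \<cdot>\<^sub>v map_vec complex_of_real x)"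
    hence i: "i < n" by (simp add: x_def)
    have "\<alpha> * of_real (x $ i) = \<alpha> * (S $$ (i, k) * T $$ (k, k))"
      using i real[OF i k] by (simp add: x_def)
    thus "col S k $ i = (\<alpha> \<cdot>\<^sub>v map_vec complex_of_real x) $ i"
      using i S k nz by (simp add: \<alpha>_def x_def)
  qed (use S in \<open>simp add: x_def\<close>)
  moreover have "mat_of_row (row T k) = \<beta> \<cdot>\<^sub>m mat_of_row (map_vec complex_of_real y)"
  proof (rule eq_matI)
    fix i j assume "i < dim_row (\<beta> \<cdot>\<^sub>m mat_of_row (map_vec complex_of_real y))"
      "j < dim_col (\<beta> \<cdot>\<^sub>m mat_of_row (map_vec complex_of_real y))"
    hence i: "i = 0" and j: "j < n" by (simp_all add: y_def)
    have "\<beta> * of_real (y $ j) = \<beta> * (S $$ (k, k) * T $$ (k, j))"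
      using j real[OF k j] by (simp add: y_def)
    thus "mat_of_row (row T k) $$ (i, j)
        = (\<beta> \<cdot>\<^sub>m mat_of_row (map_vec complex_of_real y)) $$ (i, j)"
      using i j T k nz by (simp add: \<beta>_def y_def)
  qed (use T in \<open>simp_all add: y_def\<close>)
  ultimately show ?L
    unfolding col row using nz r \<alpha>\<beta> pos k
    by (intro exI[of _ \<alpha>] exI[of _ \<beta>] exI[of _ x] exI[of _ y])
      (auto simp: positive_vec_def x_def y_def simp flip: of_real_divide)
qed

text \<open>The product of the projections for \<open>k \<noteq> l\<close> vanishes, because row \<open>k\<close> of \<open>T\<close> is orthogonal
  to column \<open>l\<close> of \<open>S\<close>.  Its entry \<open>(k, k)\<close> would be a sum of positive numbers.\<close>

lemma positive_spectral_projection_unique: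
  assumes S: "S \<in> carrier_mat n n" and T: "T \<in> carrier_mat n n" and TS: "T * S = 1\<^sub>m n"
    and k: "k < n" "positive_spectral_projection n S T k"
    and l: "l < n" "positive_spectral_projection n S T l"
  shows "k = l"
proof (rule ccontr)
  assume "k \<noteq> l"
  hence orthogonal: "0 = (\<Sum>i<n. T $$ (k, i) * S $$ (i, l))"
    using index_mult_mat_sum[OF T S k(1) l(1)] k l by (simp add: TS)
  define e where "e i = Re (S $$ (k, k) * T $$ (k, i))" for i
  define f where "f i = Re (S $$ (i, l) * T $$ (l, k))" for i
  have e: "S $$ (k, k) * T $$ (k, i) = of_real (e i)" "0 < e i" if "i < n" for i
    using k that unfolding e_def positive_spectral_projection_def by (simp_all only: of_real_Re)
  have f: "S $$ (i, l) * T $$ (l, k) = of_real (f i)" "0 < f i" if "i < n" for i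
    using k l that unfolding f_def positive_spectral_projection_def by (simp_all only: of_real_Re)
  have "of_real (\<Sum>i<n. e i * f i)
      = (\<Sum>i<n. (S $$ (k, k) * T $$ (k, i)) * (S $$ (i, l) * T $$ (l, k)))"
    by (simp add: e f)
  also have "\<dots> = S $$ (k, k) * (\<Sum>i<n. T $$ (k, i) * S $$ (i, l)) * T $$ (l, k)"
    by (simp add: sum_distrib_left sum_distrib_right mult_ac)
  also have "\<dots> = of_real 0" by (simp flip: orthogonal)
  finally have "(\<Sum>i<n. e i * f i) = 0" by (simp only: of_real_eq_iff)
  moreover have "0 < (\<Sum>i<n. e i * f i)" using k e f by (intro sum_pos) auto
  ultimately show False by simp
qed

lemma spectral_projection_index:
  fixes S T :: "complex mat"
  assumes S: "S \<in> carrier_mat n n" and T: "T \<in> carrier_mat n n" and k: "k < n"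
    and ij: "i < n" "j < n"
  shows "(S * mat_diag n (\<lambda>i. unit_vec n k $ i) * T) $$ (i, j) = S $$ (i, k) * T $$ (k, j)"
proof -
  let ?SD = "S * mat_diag n (\<lambda>i. unit_vec n k $ i)"
  have SD: "?SD = mat n n (\<lambda>(i, j). S $$ (i, j) * unit_vec n k $ j)"
    by (rule mat_diag_mult_right[OF S])
  have "?SD \<in> carrier_mat n n" by (simp add: SD)
  note index_mult_mat_sum[OF this T ij]
  also have "(\<Sum>l<n. ?SD $$ (i, l) * T $$ (l, j))
      = (\<Sum>l<n. if l = k then S $$ (i, k) * T $$ (k, j) else 0)"
    unfolding SD using ij k by (intro sum.cong refl) auto
  finally show ?thesis using k by simp
qed

text \<open>This is Perron's theorem for a diagonalizable positive matrix; \<open>k\<close> is the index of an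
  eigenvalue of largest modulus.\<close>

lemma positive_matrix_has_positive_spectral_projection:
  fixes M :: "real mat"
  assumes M: "M \<in> carrier_mat n n" and pos: "\<And>i j. i < n \<Longrightarrow> j < n \<Longrightarrow> 0 < M $$ (i, j)"
    and S: "S \<in> carrier_mat n n" and T: "T \<in> carrier_mat n n"
    and ST: "S * T = 1\<^sub>m n" and TS: "T * S = 1\<^sub>m n"
    and diag: "map_mat complex_of_real M = S * mat_diag n d * T" and n: "0 < n"
  shows "\<exists>k<n. positive_spectral_projection n S T k"
proof -
  let ?M = "map_mat complex_of_real M"
  let ?D = "mat_diag n d"
  have Mc: "?M \<in> carrier_mat n n" using M by simp
  have Dc: "?D \<in> carrier_mat n n" by simp
  have "?M * S = S * ?D * (T * S)"
    unfolding diag using S T Dc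
    by (simp add: assoc_mult_mat[of _ n n _ n _ n] mult_carrier_mat[of _ n n _ n])
  hence MS: "?M * S = S * ?D"
    using S by (simp add: TS right_mult_one_mat[of _ n n] mult_carrier_mat[of _ n n _ n])
  have "T * ?M = (T * S) * ?D * T"
    unfolding diag using S T Dc
    by (simp add: assoc_mult_mat[of _ n n _ n _ n] mult_carrier_mat[of _ n n _ n])
  hence TM: "T * ?M = ?D * T" using T by (simp add: TS left_mult_one_mat[of _ n n])
  have right: "(\<Sum>b<n. of_real (M $$ (a, b)) * S $$ (b, i)) = S $$ (a, i) * d i"
    if "a < n" "i < n" for a i
    using index_mult_mat_sum[OF Mc S that] that M S
    by (simp add: MS mat_diag_mult_right[OF S] del: index_mult_mat)
  have left: "(\<Sum>b<n. of_real (M $$ (b, a)) * T $$ (i, b)) = T $$ (i, a) * d i"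
    if "a < n" "i < n" for a i
    using index_mult_mat_sum[OF T Mc that(2,1)] that M T
    by (simp add: TM mat_diag_mult_left[OF T] mult.commute del: index_mult_mat)
  have st: "(\<Sum>i<n. S $$ (a, i) * T $$ (i, b)) = (if a = b then 1 else 0)"
    if "a < n" "b < n" for a b
    using index_mult_mat_sum[OF S T that] that by (simp add: ST)
  have ts: "(\<Sum>i<n. T $$ (i, b) * S $$ (a, i)) = (if b = a then 1 else 0)"
    if "a < n" "b < n" for a b
    using st[OF that] by (simp add: mult.commute)
  have "Max ((\<lambda>i. cmod (d i)) ` {..<n}) \<in> (\<lambda>i. cmod (d i)) ` {..<n}"
    using n by (intro Max_in) auto
  then obtain k where k: "k < n" and "cmod (d k) = Max ((\<lambda>i. cmod (d i)) ` {..<n})" by auto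
  hence dominant: "cmod (d i) \<le> cmod (d k)" if "i < n" for i using that by auto
  have tsk: "(\<Sum>i<n. T $$ (k, i) * S $$ (i, k)) = 1"
    using index_mult_mat_sum[OF T S k k] k by (simp add: TS)
  hence "(\<Sum>i<n. T $$ (k, i) * S $$ (i, k)) \<noteq> 0" by simp
  then obtain c where "c \<in> {..<n}" "T $$ (k, c) * S $$ (c, k) \<noteq> 0"
    by (rule sum.not_neutral_contains_not_neutral)
  hence c: "c < n" "T $$ (k, c) \<noteq> 0" "S $$ (c, k) \<noteq> 0" by auto
  have "\<exists>\<alpha>. \<forall>a<n. S $$ (a, k) = \<alpha> * of_real (cmod (S $$ (a, k))) \<and> S $$ (a, k) \<noteq> 0"
    by (rule dominant_eigenvector_has_constant_phase[OF pos right st k dominant c(1,3)])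
  then obtain \<alpha> where \<alpha>: "S $$ (a, k) = \<alpha> * of_real (cmod (S $$ (a, k)))" "S $$ (a, k) \<noteq> 0"
    if "a < n" for a by blast
  have "\<exists>\<beta>. \<forall>a<n. T $$ (k, a) = \<beta> * of_real (cmod (T $$ (k, a))) \<and> T $$ (k, a) \<noteq> 0"
    by (rule dominant_eigenvector_has_constant_phase[OF pos left ts k dominant c(1,2)])
  then obtain \<beta> where \<beta>: "T $$ (k, a) = \<beta> * of_real (cmod (T $$ (k, a)))" "T $$ (k, a) \<noteq> 0"
    if "a < n" for a by blast
  \<comment> \<open>Row \<open>k\<close> of \<open>T\<close> times column \<open>k\<close> of \<open>S\<close> is \<open>1\<close>, which fixes the product of the phases.\<close>
  define q where "q = (\<Sum>i<n. cmod (T $$ (k, i)) * cmod (S $$ (i, k)))"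
  have q: "0 < q"
    unfolding q_def using n \<alpha>(2) \<beta>(2) by (intro sum_pos) auto
  have "1 = (\<Sum>i<n. (\<beta> * of_real (cmod (T $$ (k, i)))) * (\<alpha> * of_real (cmod (S $$ (i, k)))))"
    unfolding tsk[symmetric] by (intro sum.cong refl) (metis \<alpha>(1) \<beta>(1) lessThan_iff)
  also have "\<dots> = \<alpha> * \<beta> * of_real q"
    by (simp add: q_def sum_distrib_left mult_ac)
  finally have \<alpha>\<beta>: "\<alpha> * \<beta> = of_real (1 / q)" using q by (simp add: field_simps)
  have "positive_spectral_projection n S T k"
    unfolding positive_spectral_projection_def
  proof (intro allI impI)
    fix i j assume ij: "i < n" "j < n"
    have "S $$ (i, k) * T $$ (k, j)
        = \<alpha> * \<beta> * of_real (cmod (S $$ (i, k)) * cmod (T $$ (k, j)))"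
      by (subst \<alpha>(1)[OF ij(1)], subst \<beta>(1)[OF ij(2)]) simp
    also have "\<dots> = of_real (cmod (S $$ (i, k)) * cmod (T $$ (k, j)) / q)"
      by (simp add: \<alpha>\<beta>)
    finally have eq: "S $$ (i, k) * T $$ (k, j) = \<dots>" .
    have "0 < cmod (S $$ (i, k)) * cmod (T $$ (k, j)) / q" using \<alpha>(2) \<beta>(2) ij q by simp
    thus "S $$ (i, k) * T $$ (k, j) \<in> \<real> \<and> 0 < Re (S $$ (i, k) * T $$ (k, j))"
      unfolding eq by simp
  qed
  with k show ?thesis by blast
qed

lemma diagonalized_power_one_plus:
  fixes A S T :: "complex mat"
  assumes S: "S \<in> carrier_mat n n" and T: "T \<in> carrier_mat n n"
    and ST: "S * T = 1\<^sub>m n" and TS: "T * S = 1\<^sub>m n" and A: "A = S * mat_diag n d * T"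
  shows "(1\<^sub>m n + A) ^\<^sub>m m = S * mat_diag n (\<lambda>i. (1 + d i) ^ m) * T"
proof (induction m)
  case 0
  thus ?case using S T by (simp add: ST A)
next
  case (Suc m)
  have c: "mat_diag n f \<in> carrier_mat n n" for f :: "nat \<Rightarrow> complex" by simp
  have sum: "1\<^sub>m n + mat_diag n d = mat_diag n (\<lambda>i. 1 + d i)"
    by (rule eq_matI) (auto simp: mat_diag_def)
  have "1\<^sub>m n + A = S * 1\<^sub>m n * T + S * mat_diag n d * T" using S by (simp add: ST A)
  also have "\<dots> = S * (1\<^sub>m n + mat_diag n d) * T"
    using S T c[of d]
    by (simp add: mult_add_distrib_mat[of _ n n _ n] add_mult_distrib_mat[of _ n n _ _ n])
  finally have B: "1\<^sub>m n + A = S * mat_diag n (\<lambda>i. 1 + d i) * T" by (simp add: sum)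
  have "(1\<^sub>m n + A) ^\<^sub>m Suc m
      = S * mat_diag n (\<lambda>i. (1 + d i) ^ m) * T * (S * mat_diag n (\<lambda>i. 1 + d i) * T)"
    by (simp add: Suc.IH B[symmetric])
  also have "\<dots> = S * mat_diag n (\<lambda>i. (1 + d i) ^ m) * (T * S) * mat_diag n (\<lambda>i. 1 + d i) * T"
    using S T c by (simp add: assoc_mult_mat[of _ n n _ n _ n]
        mult_carrier_mat[of _ n n _ n] del: mat_diag_diag)
  also have "\<dots> = S * (mat_diag n (\<lambda>i. (1 + d i) ^ m) * mat_diag n (\<lambda>i. 1 + d i)) * T"
    using S T c
    by (simp add: TS left_mult_one_mat[of _ n n] assoc_mult_mat[of _ n n _ n _ n]
        mult_carrier_mat[of _ n n _ n] del: mat_diag_diag)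
  finally show ?case by (simp add: mult.commute)
qed

text \<open>Passing from \<open>A\<close> to a power of \<open>1 + A\<close> changes the eigenvalues but not the diagonalizing
  matrix \<open>S\<close>, and the spectral projections depend on \<open>S\<close> alone.\<close>

lemma perron_similarity_iff_positive_spectral_projection:
  assumes n: "2 \<le> n" and S: "S \<in> carrier_mat n n" and inv: "invertible_mat S"
  shows "perron_similarity S \<longleftrightarrow> (\<exists>k<n. positive_spectral_projection n S (inv_mat S) k)"
proof
  define T where "T = inv_mat S"
  have T: "T \<in> carrier_mat n n" and ST: "S * T = 1\<^sub>m n" and TS: "T * S = 1\<^sub>m n"
    using inv_mat[OF S inv] by (auto simp: T_def)
  {
    assume "perron_similarity S"
    then obtain A D where A: "A \<in> carrier_mat n n" "irreducible_mat A" "nonneg_mat A"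
      and D: "D \<in> carrier_mat n n" "diagonal_mat D" and AD: "A = S * D * T"
      using S unfolding perron_similarity_def T_def by auto
    have D_eq: "D = mat_diag n (\<lambda>i. D $$ (i, i))"
      using D by (intro eq_matI) (auto simp: mat_diag_def diagonal_mat_def)
    define R where "R = map_mat Re A"
    have R: "R \<in> carrier_mat n n" using A by (simp add: R_def)
    have AR: "map_mat complex_of_real R = A"
      using A by (intro eq_matI) (auto simp: R_def nonneg_mat_def)
    obtain m where m: "\<forall>i<n. \<forall>j<n. 0 < ((1\<^sub>m n + R) ^\<^sub>m m) $$ (i, j)"
      using irreducible_imp_power_positive[OF R] A AR by (auto simp: R_def nonneg_mat_def)
    have R1: "1\<^sub>m n + R \<in> carrier_mat n n" using R by simp
    have hom_R1: "map_mat complex_of_real (1\<^sub>m n + R) = 1\<^sub>m n + A"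
      unfolding AR[symmetric] using R by (intro eq_matI) auto
    have "map_mat complex_of_real ((1\<^sub>m n + R) ^\<^sub>m m) = (1\<^sub>m n + A) ^\<^sub>m m"
      by (simp only: of_real_hom.mat_hom_pow[OF R1] hom_R1)
    also have "\<dots> = S * mat_diag n (\<lambda>i. (1 + D $$ (i, i)) ^ m) * T"
      using AD D_eq by (intro diagonalized_power_one_plus[OF S T ST TS]) simp
    finally show "\<exists>k<n. positive_spectral_projection n S (inv_mat S) k"
      unfolding T_def[symmetric] using m n
      by (intro positive_matrix_has_positive_spectral_projection[OF _ _ S T ST TS])
        (auto intro: pow_carrier_mat[OF R1])
  }
  assume "\<exists>k<n. positive_spectral_projection n S (inv_mat S) k"
  then obtain k where k: "k < n" and proj: "positive_spectral_projection n S T k"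
    by (auto simp: T_def)
  define D :: "complex mat" where "D = mat_diag n (\<lambda>i. unit_vec n k $ i)"
  have A: "S * D * T \<in> carrier_mat n n" using S T by (auto simp: D_def)
  have entry: "(S * D * T) $$ (i, j) \<in> \<real> \<and> 0 < Re ((S * D * T) $$ (i, j))"
    if "i < n" "j < n" for i j
    unfolding D_def spectral_projection_index[OF S T k that]
    using proj that by (simp add: positive_spectral_projection_def)
  have "irreducible_mat (S * D * T)"
    by (rule irreducible_if_no_zero_entry[OF A]) (use entry in force)
  moreover have "nonneg_mat (S * D * T)"
    unfolding nonneg_mat_def using entry A S T by (auto simp: less_imp_le simp del: index_mult_mat)
  moreover have "D \<in> carrier_mat n n" "diagonal_mat D"
    by (auto simp: D_def diagonal_mat_def mat_diag_def)
  moreover have "dim_row S = n" "square_mat S" using S by auto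
  ultimately show "perron_similarity S"
    unfolding perron_similarity_def T_def[symmetric] using inv A by metis
qed

lemma spectracone_nontrivial:
  assumes n: "2 \<le> n" and S: "S \<in> carrier_mat n n" and inv: "invertible_mat S"
    and k: "k < n" and proj: "positive_spectral_projection n S (inv_mat S) k"
  shows "\<not> trivial_spectracone S"
proof
  assume triv: "trivial_spectracone S"
  define T where "T = inv_mat S"
  have T: "T \<in> carrier_mat n n" using inv_mat[OF S inv] by (simp add: T_def)
  have "unit_vec n k \<in> spectracone S"
    using S T k proj unfolding spectracone_def nonneg_mat_def T_def[symmetric]
    by (auto simp: spectral_projection_index[OF S T k] positive_spectral_projection_def
        less_imp_le simp del: index_mult_mat(1))
  then obtain a where a: "unit_vec n k = complex_of_real a \<cdot>\<^sub>v vec n (\<lambda>_. 1)"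
    using triv S by (auto simp: trivial_spectracone_def)
  obtain l where l: "l < n" "l \<noteq> k"
  proof (cases "k = 0")
    case True
    thus thesis using that[of 1] n by simp
  next
    case False
    thus thesis using that[of 0] n by simp
  qed
  have "complex_of_real a = 1" using arg_cong[OF a, of "\<lambda>v. v $ k"] k by simp
  moreover have "complex_of_real a = 0" using arg_cong[OF a, of "\<lambda>v. v $ l"] l k by simp
  ultimately show False by simp
qed

theorem theorem4p14:
  fixes S :: "complex mat" and n :: nat
  assumes "2 \<le> n" and "S \<in> carrier_mat n n" and "invertible_mat S"
  shows "(perron_similarity S \<longleftrightarrow>
           (\<exists>!k. k < n \<and>
              (\<exists>\<alpha> \<beta> x y.
                 \<alpha> \<noteq> 0 \<and> \<beta> \<noteq> 0 \<and> \<alpha> * \<beta> \<in> \<real> \<and> 0 < Re (\<alpha> * \<beta>) \<and>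
                 x \<in> carrier_vec n \<and> positive_vec x \<and>
                 y \<in> carrier_vec n \<and> positive_vec y \<and>
                 S *\<^sub>v unit_vec n k = \<alpha> \<cdot>\<^sub>v map_vec complex_of_real x \<and>
                 mat_of_row (unit_vec n k) * inv_mat S =
                   \<beta> \<cdot>\<^sub>m mat_of_row (map_vec complex_of_real y))))
         \<and> (perron_similarity S \<longrightarrow> \<not> trivial_spectracone S)"
proof -
  note inverse = inv_mat[OF assms(2,3)]
  note perron_iff = perron_similarity_iff_positive_spectral_projection[OF assms]
  note unique = positive_spectral_projection_unique[OF assms(2) inverse(1,3)]
  note column_row_iff = positive_spectral_projection_iff[OF assms(2) inverse(1)]
  show ?thesis
    unfolding perron_iff column_row_iff
    using unique spectracone_nontrivial[OF assms] by metis
qed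

end
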